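(* Suppose that the following hypotheses hold. (Permutation) $\widehat A_{\mathfrak h,\eta}\equiv\widehat A_{\eta,\mathfrak h}$ for all $\mathfrak h,\eta\in\mathfrak H$. (Upper function) For every $n\ge 1$, $$\sup_{f\in\mathbb F}\mathbb E^{(n)}_{1,f}\Big(\sup_{\mathfrak h\in\mathfrak H_n}\big[\ell(\widehat A_{\mathfrak h},\Lambda_{\mathfrak h}(f))-\Psi_n(\mathfrak h)\big]_+^q\Big)\le\varepsilon_n^q,$$ $$\sup_{f\in\mathbb F}\mathbb E^{(n)}_{1,f}\Big(\sup_{\mathfrak h,\eta\in\mathfrak H_n}\big[\ell(\widehat A_{\mathfrak h,\eta},\Lambda_{\mathfrak h,\eta}(f))-\min\{\Psi_n(\mathfrak h),\Psi_n(\eta)\}\big]_+^q\Big)\le\varepsilon_n^q.$$ Suppose additionally that there is a constant $C_\ell>0$ such that for all $f\in\mathbb F$, $n\ge1$, $\mathfrak h\in\mathfrak H_n$ $$\rho(\Upsilon_{\mathfrak h}(f),B(f))\le C_\ell\,\ell(\Lambda_{\mathfrak h}(f),A(f)),$$ and that there is a constant $C_{\mathcal E}>0$ such that for all $n\ge1$ and $\mathfrak h\in\mathfrak H_n$ $$\sup_{f\in\mathbb F}\mathcal E_n(f,\mathfrak h)\le C_{\mathcal E}\Psi_n(\mathfrak h).$$ Let $\hat{\mathfrak h}^{(n)}$ be selected by the $(\Psi_n,\ell)$-selection rule. Then for every $f\in\mathbb F$ and $n\ge1$ $$\mathcal R_B\big[\widehat B_{\hat{\mathfrak h}^{(n)}},f\big]\le\inf_{\mathfrak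 h\in\mathfrak H_n}\Big\{(2C_\ell+C_{\mathcal E})\mathcal B_A^{(n)}(f,\mathfrak h)+(7C_\ell+2C_{\mathcal E})\psi_n(f,\mathfrak h)\Big\}+(10C_\ell+3C_{\mathcal E})\varepsilon_n.$$
   Context: Setting. For each $n\ge1$ let $(\mathcal X^{(n)},\mathfrak T^{(n)},\mathbb P^{(n)}_f, f\in\mathbb F)$ be a statistical experiment generated by an observation $X^{(n)}=(X^{(n)}_1,X^{(n)}_2)$, where $X_1^{(n)},X_2^{(n)}$ are independent random elements with marginal laws $\mathbb P^{(n)}_{1,f},\mathbb P^{(n)}_{2,f}$; $\mathbb E^{(n)}_f,\mathbb E^{(n)}_{1,f},\mathbb E^{(n)}_{2,f}$ are the corresponding expectations. Let $A:\mathbb F\to\mathfrak S_1$ and $B:\mathbb F\to\mathfrak S_2$ be maps to be estimated, where $\mathfrak S_1,\mathfrak S_2$ are endowed with semi-metrics $\ell,\rho$ respectively. Let $q\ge1$ be fixed. For an $X^{(n)}$-measurable $\mathfrak S_2$-valued map $\widetilde Q$ put $\mathcal R_B[\widetilde Q,f]=\big(\mathbb E^{(n)}_f[\rho(\widetilde Q,B(f))]^q\big)^{1/q}$. Let $\mathfrak H$ be a parameter set, $\mathfrak H_n\subseteq\mathfrak H$ countable subsets, $\{\widehat A_{\mathfrak h}\}_{\mathfrak h\in\mathfrak H}$ and $\{\widehat A_{\mathfrak h,\eta}\}_{\mathfrak h,\eta\in\mathfrak H}$ families of $X_1^{(n)}$-measurable $\mathfrak S_1$-valued maps (possibly depending on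 $n$), $\{\Lambda_{\mathfrak h}(f)\}$ and $\{\Lambda_{\mathfrak h,\eta}(f)\}$ ($\mathfrak h,\eta\in\mathfrak H$, $f\in\mathbb F$) collections of $\mathfrak S_1$-valued functionals (possibly depending on $n$), and $\{\Psi_n(\mathfrak h)\}_{\mathfrak h\in\mathfrak H}$ positive $X_1^{(n)}$-measurable random variables. Let $\{\widehat B_{\mathfrak h}\}_{\mathfrak h\in\mathfrak H}$ be a family of $X_2^{(n)}$-measurable $\mathfrak S_2$-valued maps and $\{\Upsilon_{\mathfrak h}(f)\}$ ($\mathfrak h\in\mathfrak H$, $f\in\mathbb F$) a collection of $\mathfrak S_2$-valued functionals. Let $\varepsilon_n\ge0$, $\varepsilon_n\to0$, be a given sequence. Random quantities whose expectations appear are understood to be measurable. $[x]_+=\max(x,0)$. $(\Psi_n,\ell)$-selection rule. Put $$\widehat R_n(\mathfrak h)=\sup_{\eta\in\mathfrak H_n}\big[\ell(\widehat A_{\mathfrak h,\eta},\widehat A_\eta)-2\Psi_n(\eta)\big]_+,\quad \mathfrak h\in\mathfrak H_n,$$ and let $\hat{\mathfrak h}^{(n)}\in\mathfrak H_n$ be an arbitrary $X_1^{(n)}$-measurable random element satisfying $$\widehat R_n(\hat{\mathfrak h}^{(n)})+2\Psi_n(\hat{\mathfrak h}^{(n)})\le\inf_{\mathfrak h\in\mathfrak H_n}\{\widehat R_n(\mathfrak h)+2\Psi_n(\mathfrak h)\}+\varepsilon_n',$$ where $\varepsilon_n'$ is an arbitrary sequence with $\varepsilon'_n\le\varepsilon_n$.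 Notation: for $f\in\mathbb F$, $\mathfrak h\in\mathfrak H_n$, $$\mathcal B^{(n)}_A(f,\mathfrak h)=\ell(\Lambda_{\mathfrak h}(f),A(f))+2\sup_{\eta\in\mathfrak H_n}\ell(\Lambda_{\mathfrak h,\eta}(f),\Lambda_\eta(f)),\qquad \psi_n(f,\mathfrak h)=\big[\mathbb E^{(n)}_{1,f}\{\Psi_n^q(\mathfrak h)\}\big]^{1/q},$$ $$\mathcal E_n(f,\mathfrak h)=\big(\mathbb E^{(n)}_{2,f}\{\rho^q(\widehat B_{\mathfrak h},\Upsilon_{\mathfrak h}(f))\}\big)^{1/q}.$$ *)

theory Defs
  imports "HOL-Probability.Probability"
begin

text \<open>
  Distances need not separate points. Suprema, infima and expectations of nonnegative quantities
  are taken in \<^typ>\<open>ennreal\<close>, so that none of them is implicitly assumed to be finite.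
\<close>

definition semimetric :: "('a \<Rightarrow> 'a \<Rightarrow> real) \<Rightarrow> bool" where
  "semimetric d \<longleftrightarrow>
     (\<forall>x y. 0 \<le> d x y) \<and> (\<forall>x. d x x = 0) \<and> (\<forall>x y. d x y = d y x) \<and>
     (\<forall>x y z. d x z \<le> d x y + d y z)"

text \<open>Only used for exponents \<open>p > 0\<close>.\<close>

definition enn_powr :: "ennreal \<Rightarrow> real \<Rightarrow> ennreal" where
  "enn_powr x p = (if x = \<infinity> then \<infinity> else ennreal (enn2real x powr p))"

text \<open>The moment \<open>(E Z\<^sup>q)\<^bsup>1/q\<^esup>\<close> of a nonnegative random variable.\<close>

definition moment_norm :: "'a measure \<Rightarrow> real \<Rightarrow> ('a \<Rightarrow> real) \<Rightarrow> ennreal" where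
  "moment_norm M q Z = enn_powr (\<integral>\<^sup>+x. ennreal (Z x powr q) \<partial>M) (1 / q)"

text \<open>
  Independence of two random elements with values in possibly different types, stated for the
  generated sigma-algebras: \<^const>\<open>prob_space.indep_var\<close> forces both value types to coincide.
\<close>

definition indep_elements ::
  "'w measure \<Rightarrow> 'x measure \<Rightarrow> ('w \<Rightarrow> 'x) \<Rightarrow> 'y measure \<Rightarrow> ('w \<Rightarrow> 'y) \<Rightarrow> bool" where
  "indep_elements M S X T Y \<longleftrightarrow>
     prob_space.indep_set M (sets (vimage_algebra (space M) X S)) (sets (vimage_algebra (space M) Y T))"

text \<open>
  \<open>\<Omega>\<close> supplies the measurable space, \<open>P f\<close> the law for parameter \<open>f\<close>; the observation is the
  pair \<open>(X1, X2)\<close> with values in the measurable spaces \<open>S1\<close>, \<open>S2\<close>. The marginal laws are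
  \<open>distr (P f) S1 X1\<close> and \<open>distr (P f) S2 X2\<close>.
\<close>

definition two_sample_experiment ::
  "'w measure \<Rightarrow> ('f \<Rightarrow> 'w measure) \<Rightarrow> 'x measure \<Rightarrow> ('w \<Rightarrow> 'x) \<Rightarrow> 'y measure \<Rightarrow> ('w \<Rightarrow> 'y) \<Rightarrow> bool" where
  "two_sample_experiment \<Omega> P S1 X1 S2 X2 \<longleftrightarrow>
     X1 \<in> \<Omega> \<rightarrow>\<^sub>M S1 \<and> X2 \<in> \<Omega> \<rightarrow>\<^sub>M S2 \<and>
     (\<forall>f. prob_space (P f) \<and> sets (P f) = sets \<Omega> \<and> indep_elements (P f) S1 X1 S2 X2)"

text \<open>
  In the following, \<open>Ah \<hh>\<close> and \<open>Ap \<hh> \<eta>\<close> are the one- and two-index estimators as functions of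
  the observed value \<open>x\<close>, \<open>H\<close> is the countable parameter set, and \<open>L \<hh>\<close>, \<open>Lp \<hh> \<eta>\<close> are the one- and
  two-index functionals.
\<close>

definition Rhat ::
  "('s \<Rightarrow> 's \<Rightarrow> real) \<Rightarrow> 'h set \<Rightarrow> ('h \<Rightarrow> 'x \<Rightarrow> 's) \<Rightarrow> ('h \<Rightarrow> 'h \<Rightarrow> 'x \<Rightarrow> 's) \<Rightarrow> ('h \<Rightarrow> 'x \<Rightarrow> real) \<Rightarrow>
     'h \<Rightarrow> 'x \<Rightarrow> ennreal" where
  "Rhat l H Ah Ap \<Psi> \<hh> x = (SUP \<eta>\<in>H. ennreal (max (l (Ap \<hh> \<eta> x) (Ah \<eta> x) - 2 * \<Psi> \<eta> x) 0))"

text \<open>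
  A negative tolerance \<open>\<epsilon>'\<close> is read as \<open>0\<close> by \<^const>\<open>ennreal\<close>. This excludes nothing: with
  \<open>\<epsilon>' < 0\<close> the inequality can hold only if the infimum is infinite, and then it also holds here.
\<close>

definition selected ::
  "('s \<Rightarrow> 's \<Rightarrow> real) \<Rightarrow> 'h set \<Rightarrow> ('h \<Rightarrow> 'x \<Rightarrow> 's) \<Rightarrow> ('h \<Rightarrow> 'h \<Rightarrow> 'x \<Rightarrow> 's) \<Rightarrow> ('h \<Rightarrow> 'x \<Rightarrow> real) \<Rightarrow>
     real \<Rightarrow> 'h \<Rightarrow> 'x \<Rightarrow> bool" where
  "selected l H Ah Ap \<Psi> \<epsilon>' \<hh> x \<longleftrightarrow>
     \<hh> \<in> H \<and>
     Rhat l H Ah Ap \<Psi> \<hh> x + ennreal (2 * \<Psi> \<hh> x)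
       \<le> (INF h\<in>H. Rhat l H Ah Ap \<Psi> h x + ennreal (2 * \<Psi> h x)) + ennreal \<epsilon>'"

definition bias ::
  "('s \<Rightarrow> 's \<Rightarrow> real) \<Rightarrow> 'h set \<Rightarrow> ('h \<Rightarrow> 'f \<Rightarrow> 's) \<Rightarrow> ('h \<Rightarrow> 'h \<Rightarrow> 'f \<Rightarrow> 's) \<Rightarrow> ('f \<Rightarrow> 's) \<Rightarrow>
     'f \<Rightarrow> 'h \<Rightarrow> ennreal" where
  "bias l H L Lp A f \<hh> = ennreal (l (L \<hh> f) (A f)) + 2 * (SUP \<eta>\<in>H. ennreal (l (Lp \<hh> \<eta> f) (L \<eta> f)))"

text \<open>The quantities inside the two expectations of the upper function hypothesis.\<close>

definition excess1 ::
  "('s \<Rightarrow> 's \<Rightarrow> real) \<Rightarrow> real \<Rightarrow> 'h set \<Rightarrow> ('h \<Rightarrow> 'x \<Rightarrow> 's) \<Rightarrow> ('h \<Rightarrow> 'f \<Rightarrow> 's) \<Rightarrow> ('h \<Rightarrow> 'x \<Rightarrow> real) \<Rightarrow>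
     'f \<Rightarrow> 'x \<Rightarrow> ennreal" where
  "excess1 l q H Ah L \<Psi> f x =
     (SUP \<hh>\<in>H. ennreal (max (l (Ah \<hh> x) (L \<hh> f) - \<Psi> \<hh> x) 0 powr q))"

definition excess2 ::
  "('s \<Rightarrow> 's \<Rightarrow> real) \<Rightarrow> real \<Rightarrow> 'h set \<Rightarrow> ('h \<Rightarrow> 'h \<Rightarrow> 'x \<Rightarrow> 's) \<Rightarrow> ('h \<Rightarrow> 'h \<Rightarrow> 'f \<Rightarrow> 's) \<Rightarrow>
     ('h \<Rightarrow> 'x \<Rightarrow> real) \<Rightarrow> 'f \<Rightarrow> 'x \<Rightarrow> ennreal" where
  "excess2 l q H Ap Lp \<Psi> f x =
     (SUP \<hh>\<in>H. SUP \<eta>\<in>H. ennreal (max (l (Ap \<hh> \<eta> x) (Lp \<hh> \<eta> f) - min (\<Psi> \<hh> x) (\<Psi> \<eta> x)) 0 powr q))"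

end

theory Submission
  imports Defs
begin

text \<open>
  Let \<open>k\<close> be the selected index, \<open>u\<close> and \<open>v\<close> the two suprema of the upper function hypothesis, \<open>s\<close> the
  supremum in the bias, and \<open>h\<close> a competitor. Pointwise \<open>Rhat h \<le> s + u + v\<close>, so the selection rule
  bounds \<open>\<Psi> k\<close>, and by the permutation hypothesis (passing from \<open>Ah k\<close> to \<open>Ah h\<close> through
  \<open>Ap k h = Ap h k\<close>) also \<open>l (L k f) (A f)\<close>, by \<open>\<Psi> h\<close>, the bias at \<open>h\<close>, \<open>u\<close>, \<open>v\<close> and \<open>\<epsilon>\<close>. The loss of the
  plug-in estimator is at most \<open>\<rho> (Bh k) (\<Upsilon> k f) + Cl * l (L k f) (A f)\<close>; since \<open>k\<close> depends on \<open>X1\<close>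
  only, independence allows integrating the first term over \<open>X2\<close> with \<open>k\<close> fixed, which leaves
  \<open>CE * \<Psi> k\<close>. Minkowski's inequality collects the terms.
\<close>

section \<open>Real powers on the extended nonnegative reals\<close>

lemma enn_powr_ennreal: "0 \<le> x \<Longrightarrow> enn_powr (ennreal x) p = ennreal (x powr p)"
  by (simp add: enn_powr_def)

lemma enn_powr_top [simp]: "enn_powr \<top> p = \<top>"
  by (simp add: enn_powr_def)

lemma enn_powr_one [simp]: "enn_powr x 1 = x"
  by (cases x) (auto simp: enn_powr_ennreal)

lemma enn_powr_enn_powr: "enn_powr (enn_powr x a) b = enn_powr x (a * b)"
  by (cases x) (auto simp: enn_powr_ennreal powr_powr)

lemma enn_powr_mono: "0 \<le> p \<Longrightarrow> x \<le> y \<Longrightarrow> enn_powr x p \<le> enn_powr y p"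
  by (cases x; cases y) (auto simp: enn_powr_ennreal top_unique intro!: ennreal_leI powr_mono2)

text \<open>The powers with exponents \<open>p\<close> and \<open>1 / p\<close> are mutually inverse
  and monotone, so an exponent can be moved across an inequality, infinite values included.\<close>

lemma enn_powr_le_iff:
  assumes "0 < p"
  shows "enn_powr x p \<le> y \<longleftrightarrow> x \<le> enn_powr y (1 / p)"
proof
  assume "enn_powr x p \<le> y"
  from enn_powr_mono[OF _ this, of "1 / p"] show "x \<le> enn_powr y (1 / p)"
    using assms by (simp add: enn_powr_enn_powr)
next
  assume "x \<le> enn_powr y (1 / p)"
  from enn_powr_mono[OF _ this, of p] show "enn_powr x p \<le> y"
    using assms by (simp add: enn_powr_enn_powr)
qed

lemma enn_powr_mult:
  assumes "0 < p"
  shows "enn_powr (x * y) p = enn_powr x p * enn_powr y p"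
proof (cases x; cases y)
  fix a b assume "x = ennreal a" "0 \<le> a" "y = ennreal b" "0 \<le> b"
  then show ?thesis
    by (simp add: enn_powr_ennreal powr_mult flip: ennreal_mult)
next
  fix a assume "x = ennreal a" "0 \<le> a" "y = \<top>"
  then show ?thesis
    using assms by (cases "a = 0") (auto simp: enn_powr_ennreal ennreal_mult_top enn_powr_def)
next
  fix b assume "x = \<top>" "y = ennreal b" "0 \<le> b"
  then show ?thesis
    using assms by (cases "b = 0") (auto simp: enn_powr_ennreal ennreal_top_mult enn_powr_def)
qed (simp add: ennreal_mult_top)

lemma enn_powr_measurable [measurable (raw)]:
  assumes [measurable]: "f \<in> borel_measurable M"
  shows "(\<lambda>x. enn_powr (f x) p) \<in> borel_measurable M"
proof -
  have "{x \<in> space M. f x = \<infinity>} = f -` {\<infinity>} \<inter> space M"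
    by auto
  also have "\<dots> \<in> sets M"
    by measurable
  finally have [measurable]: "Measurable.pred M (\<lambda>x. f x = \<infinity>)"
    by (simp add: pred_def)
  show ?thesis
    unfolding enn_powr_def by measurable
qed

text \<open>Convexity applied to \<open>x + y = t * (x / t) + (1 - t) * (y / (1 - t))\<close>.\<close>

lemma powr_add_le_weighted:
  fixes x y t q :: real
  assumes q: "1 \<le> q" and t: "0 < t" "t < 1" and xy: "0 \<le> x" "0 \<le> y"
  shows "(x + y) powr q \<le> t powr (1 - q) * x powr q + (1 - t) powr (1 - q) * y powr q"
proof -
  \<comment> \<open>Each weight is at least 1, which settles the cases where one of the two summands
    vanishes.\<close>
  have le: "z powr q \<le> s powr (1 - q) * z powr q" if "0 < s" "s < 1" for s z :: real
  proof -
    have "1 \<le> s powr (1 - q)"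
      using powr_mono_both'[of "1 - q" 0 s 1] that q
      by (metis diff_le_0_iff_le less_eq_real_def powr_mono' powr_zero_eq_one less_irrefl)
    then show ?thesis
      by (simp add: mult_le_cancel_right1)
  qed
  have sc: "s * (z / s) powr q = s powr (1 - q) * z powr q" if "0 < s" "0 \<le> z" for s z :: real
    using that by (simp add: powr_divide powr_diff)
  consider "x = 0" | "y = 0" | "0 < x" "0 < y"
    using xy by fastforce
  then show ?thesis
  proof cases
    case 3
    have "(t * (x / t) + (1 - t) * (y / (1 - t))) powr q
        \<le> t * (x / t) powr q + (1 - t) * (y / (1 - t)) powr q"
      using convex_onD[OF powr_convex[OF q], of t "y / (1 - t)" "x / t"] t 3 by (simp add: add.commute)
    then show ?thesis
      using t xy by (simp add: sc)
  qed (use le[of t x] le[of "1 - t" y] t q in auto)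
qed

lemma enn_powr_add_le_weighted:
  assumes "1 \<le> q" "0 < t" "t < 1"
  shows "enn_powr (x + y) q
    \<le> ennreal (t powr (1 - q)) * enn_powr x q + ennreal ((1 - t) powr (1 - q)) * enn_powr y q"
proof (cases x; cases y)
  fix a b assume "x = ennreal a" "0 \<le> a" "y = ennreal b" "0 \<le> b"
  then show ?thesis
    using powr_add_le_weighted[of q t a b] assms
    by (simp add: enn_powr_ennreal flip: ennreal_mult ennreal_plus)
qed (use assms in \<open>auto simp: ennreal_mult_top enn_powr_ennreal\<close>)

section \<open>Moment norms and Minkowski's inequality\<close>

text \<open>The usual q-norm of a function with extended values. Such values occur because the
  suprema in the excesses and in the bias may be infinite, whereas \<open>moment_norm\<close>
  accepts real functions only.\<close>

definition nn_norm :: "'a measure \<Rightarrow> real \<Rightarrow> ('a \<Rightarrow> ennreal) \<Rightarrow> ennreal" where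
  "nn_norm M q F = enn_powr (\<integral>\<^sup>+x. enn_powr (F x) q \<partial>M) (1 / q)"

lemma moment_norm_eq_nn_norm:
  assumes "\<And>x. x \<in> space M \<Longrightarrow> 0 \<le> Z x"
  shows "moment_norm M q Z = nn_norm M q (\<lambda>x. ennreal (Z x))"
  unfolding moment_norm_def nn_norm_def
  by (intro arg_cong2[of _ _ _ _ enn_powr] nn_integral_cong) (simp_all add: enn_powr_ennreal assms)

lemma nn_norm_le_iff:
  assumes "0 < q"
  shows "nn_norm M q F \<le> c \<longleftrightarrow> (\<integral>\<^sup>+x. enn_powr (F x) q \<partial>M) \<le> enn_powr c q"
  using enn_powr_le_iff[of "1 / q"] assms by (simp add: nn_norm_def)

lemma nn_norm_mono:
  assumes "0 < q" "\<And>x. x \<in> space M \<Longrightarrow> F x \<le> G x"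
  shows "nn_norm M q F \<le> nn_norm M q G"
  unfolding nn_norm_def using assms by (intro enn_powr_mono nn_integral_mono) auto

lemma nn_norm_cmult:
  assumes "0 < q" and [measurable]: "F \<in> borel_measurable M"
  shows "nn_norm M q (\<lambda>x. c * F x) = c * nn_norm M q F"
  using assms(1) by (simp add: nn_norm_def enn_powr_mult nn_integral_cmult enn_powr_enn_powr)

lemma (in prob_space) nn_norm_const:
  "0 < q \<Longrightarrow> nn_norm M q (\<lambda>x. c) = c"
  by (simp add: nn_norm_def emeasure_space_1 enn_powr_enn_powr)

text \<open>Minkowski's inequality with strictly positive bounds in place of the norms. It comes
  from integrating the weighted convexity inequality; positivity of \<open>a\<close> and
  \<open>b\<close> puts the weight strictly between 0 and 1.\<close>

lemma nn_norm_triangle_aux: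
  assumes q: "1 \<le> q" and ab: "0 < a" "0 < b"
    and [measurable]: "F \<in> borel_measurable M" "G \<in> borel_measurable M"
    and F: "nn_norm M q F \<le> ennreal a" and G: "nn_norm M q G \<le> ennreal b"
  shows "nn_norm M q (\<lambda>x. F x + G x) \<le> ennreal (a + b)"
proof -
  have q0: "0 < q"
    using q by simp
  \<comment> \<open>With this weight the two integrated terms become
    \<open>(a + b) powr (q - 1)\<close> times \<open>a\<close> and times \<open>b\<close>, and these
    add up to \<open>(a + b) powr q\<close>.\<close>
  define t where "t = a / (a + b)"
  have t: "0 < t" "t < 1" "1 - t = b / (a + b)"
    using ab by (auto simp: t_def field_simps)
  have sc: "(z / (a + b)) powr (1 - q) * z powr q = (a + b) powr (q - 1) * z" if "0 < z" for z
    using that ab powr_add[of z "1 - q" q] powr_minus_divide[of "a + b" "q - 1"]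
    by (simp add: powr_divide)
  have "(\<integral>\<^sup>+x. enn_powr (F x + G x) q \<partial>M)
      \<le> (\<integral>\<^sup>+x. ennreal (t powr (1 - q)) * enn_powr (F x) q
              + ennreal ((1 - t) powr (1 - q)) * enn_powr (G x) q \<partial>M)"
    using q t by (intro nn_integral_mono enn_powr_add_le_weighted)
  also have "\<dots> = ennreal (t powr (1 - q)) * (\<integral>\<^sup>+x. enn_powr (F x) q \<partial>M)
      + ennreal ((1 - t) powr (1 - q)) * (\<integral>\<^sup>+x. enn_powr (G x) q \<partial>M)"
    by (simp add: nn_integral_add nn_integral_cmult)
  also have "\<dots> \<le> ennreal (t powr (1 - q)) * ennreal (a powr q)
      + ennreal ((1 - t) powr (1 - q)) * ennreal (b powr q)"
    using F G ab by (intro add_mono mult_left_mono)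
      (auto simp: nn_norm_le_iff[OF q0] enn_powr_ennreal)
  also have "\<dots> = ennreal ((a + b) powr q)"
  proof -
    have "t powr (1 - q) * a powr q + (1 - t) powr (1 - q) * b powr q
        = (a + b) powr (q - 1) * (a + b)"
      unfolding t(3) unfolding t_def using ab by (simp only: sc distrib_left)
    also have "\<dots> = (a + b) powr q"
      using ab by (simp add: powr_diff)
    finally show ?thesis
      by (simp flip: ennreal_mult ennreal_plus)
  qed
  finally show ?thesis
    using ab by (simp add: nn_norm_le_iff[OF q0] enn_powr_ennreal del: ennreal_plus)
qed

lemma nn_norm_triangle:
  assumes q: "1 \<le> q" and FG: "F \<in> borel_measurable M" "G \<in> borel_measurable M"
  shows "nn_norm M q (\<lambda>x. F x + G x) \<le> nn_norm M q F + nn_norm M q G"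
proof (rule ennreal_le_epsilon)
  fix e :: real
  assume fin: "nn_norm M q F + nn_norm M q G < top" and e: "0 < e"
  then obtain a b where a: "nn_norm M q F = ennreal a" "0 \<le> a"
    and b: "nn_norm M q G = ennreal b" "0 \<le> b"
    by (cases "nn_norm M q F"; cases "nn_norm M q G") auto
  \<comment> \<open>Either norm may be 0, so each bound is enlarged by \<open>e / 2\<close> to be
    strictly positive.\<close>
  have "nn_norm M q (\<lambda>x. F x + G x) \<le> ennreal ((a + e / 2) + (b + e / 2))"
    using a b e by (intro nn_norm_triangle_aux q FG) (auto intro!: ennreal_leI)
  then show "nn_norm M q (\<lambda>x. F x + G x) \<le> nn_norm M q F + nn_norm M q G + ennreal e"
    using a b e by (simp add: algebra_simps flip: ennreal_plus)
qed

section \<open>Integration over independent samples\<close>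

text \<open>Independence makes the joint law and the product of the marginals agree on rectangles,
  hence everywhere; Tonelli's theorem then splits the integral.\<close>

lemma (in prob_space) nn_integral_indep_elements:
  assumes indep: "indep_elements M S X T Y"
    and [measurable]: "X \<in> M \<rightarrow>\<^sub>M S" "Y \<in> M \<rightarrow>\<^sub>M T" "F \<in> borel_measurable (S \<Otimes>\<^sub>M T)"
  shows "(\<integral>\<^sup>+\<omega>. F (X \<omega>, Y \<omega>) \<partial>M) = (\<integral>\<^sup>+\<omega>. \<integral>\<^sup>+y. F (X \<omega>, y) \<partial>distr M T Y \<partial>M)"
proof -
  interpret X: prob_space "distr M S X"
    by (rule prob_space_distr) measurable
  interpret Y: prob_space "distr M T Y"
    by (rule prob_space_distr) measurable
  have joint: "distr M S X \<Otimes>\<^sub>M distr M T Y = distr M (S \<Otimes>\<^sub>M T) (\<lambda>\<omega>. (X \<omega>, Y \<omega>))"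
  proof (rule pair_measure_eqI)
    fix U V assume UV: "U \<in> sets (distr M S X)" "V \<in> sets (distr M T Y)"
    then have [measurable]: "U \<in> sets S" "V \<in> sets T"
      by auto
    have "prob ((X -` U \<inter> space M) \<inter> (Y -` V \<inter> space M))
        = prob (X -` U \<inter> space M) * prob (Y -` V \<inter> space M)"
      using indep unfolding indep_elements_def
      by (rule indep_setD) (use UV in \<open>auto intro: in_vimage_algebra\<close>)
    moreover have "(\<lambda>\<omega>. (X \<omega>, Y \<omega>)) -` (U \<times> V) \<inter> space M
        = (X -` U \<inter> space M) \<inter> (Y -` V \<inter> space M)"
      by auto
    ultimately show "emeasure (distr M S X) U * emeasure (distr M T Y) V
        = emeasure (distr M (S \<Otimes>\<^sub>M T) (\<lambda>\<omega>. (X \<omega>, Y \<omega>))) (U \<times> V)"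
      by (simp add: emeasure_distr emeasure_eq_measure ennreal_mult)
  qed (auto simp: X.sigma_finite_measure_axioms Y.sigma_finite_measure_axioms intro!: sets_pair_measure_cong)
  have [measurable]: "F \<in> borel_measurable (S \<Otimes>\<^sub>M distr M T Y)"
    using assms(4) by (simp cong: measurable_cong_sets sets_pair_measure_cong)
  have "(\<integral>\<^sup>+\<omega>. F (X \<omega>, Y \<omega>) \<partial>M) = (\<integral>\<^sup>+z. F z \<partial>(distr M S X \<Otimes>\<^sub>M distr M T Y))"
    unfolding joint by (subst nn_integral_distr) auto
  also have "\<dots> = (\<integral>\<^sup>+x. \<integral>\<^sup>+y. F (x, y) \<partial>distr M T Y \<partial>distr M S X)"
    by (rule Y.nn_integral_fst[symmetric]) simp
  also have "\<dots> = (\<integral>\<^sup>+\<omega>. \<integral>\<^sup>+y. F (X \<omega>, y) \<partial>distr M T Y \<partial>M)"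
    by (subst nn_integral_distr) auto
  finally show ?thesis .
qed

section \<open>Upper functions, and norms of affine combinations\<close>

text \<open>The positive part of \<open>a - m\<close> has its q-th power below \<open>E\<close>, so
  it is itself below the q-th root of \<open>E\<close>. A negative \<open>m\<close> causes no harm,
  because \<open>ennreal\<close> truncates it at 0.\<close>

lemma le_add_enn_powr_excess:
  assumes q: "0 < q" and le: "ennreal (max (a - m) 0 powr q) \<le> E"
  shows "ennreal a \<le> ennreal m + enn_powr E (1 / q)"
proof -
  have "ennreal a \<le> ennreal (max m 0 + max (a - m) 0)"
    by (rule ennreal_leI) auto
  also have "\<dots> = ennreal m + ennreal (max (a - m) 0)"
    by simp
  also have "enn_powr (ennreal (max (a - m) 0)) q \<le> E"
    using le by (subst enn_powr_ennreal) auto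
  then have "ennreal (max (a - m) 0) \<le> enn_powr E (1 / q)"
    using q by (simp add: enn_powr_le_iff)
  finally show ?thesis
    by (simp add: add_left_mono)
qed

lemma le_add_excess1:
  assumes "0 < q" "h \<in> H"
  shows "ennreal (l (Ah h x) (L h f)) \<le> ennreal (\<Psi> h x) + enn_powr (excess1 l q H Ah L \<Psi> f x) (1 / q)"
  unfolding excess1_def
  by (intro le_add_enn_powr_excess[OF assms(1)] SUP_upper2[OF assms(2)] order.refl)

lemma le_add_excess2:
  assumes "0 < q" "h \<in> H" "k \<in> H"
  shows "ennreal (l (Ap h k x) (Lp h k f))
    \<le> ennreal (min (\<Psi> h x) (\<Psi> k x)) + enn_powr (excess2 l q H Ap Lp \<Psi> f x) (1 / q)"
  unfolding excess2_def
  by (intro le_add_enn_powr_excess[OF assms(1)] SUP_upper2[OF assms(2)] SUP_upper2[OF assms(3)] order.refl)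

text \<open>Repeated use of Minkowski's inequality; a constant is its own norm under a probability
  measure. The coefficients are extended reals, so an infinite bias is covered.\<close>

lemma nn_norm_affine_le:
  assumes M: "prob_space M" and q: "1 \<le> q"
    and [measurable]: "F \<in> borel_measurable M" "G \<in> borel_measurable M" "K \<in> borel_measurable M"
  shows "nn_norm M q (\<lambda>x. c + a * F x + b * G x + d * K x)
    \<le> c + a * nn_norm M q F + b * nn_norm M q G + d * nn_norm M q K"
proof -
  interpret prob_space M
    by fact
  have q0: "0 < q"
    using q by simp
  have "nn_norm M q (\<lambda>x. c + a * F x + b * G x + d * K x)
      \<le> nn_norm M q (\<lambda>x. c) + nn_norm M q (\<lambda>x. a * F x) + nn_norm M q (\<lambda>x. b * G x)
        + nn_norm M q (\<lambda>x. d * K x)"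
    by (intro order.trans[OF nn_norm_triangle[OF q]] add_right_mono) (auto intro!: nn_norm_triangle[OF q])
  also have "\<dots> = c + a * nn_norm M q F + b * nn_norm M q G + d * nn_norm M q K"
    by (simp add: nn_norm_const nn_norm_cmult q0)
  finally show ?thesis .
qed

section \<open>Pointwise consequences of the selection rule\<close>

lemma selected_bounds:
  fixes l q H Ah Ap L Lp \<Psi> f x h
  defines "u \<equiv> enn_powr (excess1 l q H Ah L \<Psi> f x) (1 / q)"
    and "v \<equiv> enn_powr (excess2 l q H Ap Lp \<Psi> f x) (1 / q)"
    and "s \<equiv> (SUP \<eta>\<in>H. ennreal (l (Lp h \<eta> f) (L \<eta> f)))"
  assumes l: "semimetric l" and q: "0 < q" and h: "h \<in> H"
    and sel: "selected l H Ah Ap \<Psi> e k x" and e: "e \<le> d" "0 \<le> d"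
    and sym: "\<And>h \<eta>. Ap h \<eta> x = Ap \<eta> h x" and pos: "\<And>h. 0 < \<Psi> h x"
  shows "ennreal (\<Psi> k x) \<le> (s + ennreal d) + ennreal (\<Psi> h x) + u + v" (is ?A)
    and "ennreal (l (L k f) (A f))
      \<le> (ennreal (l (L h f) (A f)) + 3 * s + 2 * ennreal d) + 6 * ennreal (\<Psi> h x) + 5 * u + 3 * v" (is ?B)
proof -
  have nonneg: "0 \<le> l a b" and commute: "l a b = l b a" and triangle: "l a c \<le> l a b + l b c" for a b c
    using l by (auto simp: semimetric_def)
  have k: "k \<in> H"
    using sel by (simp add: selected_def)
  have "?A \<and> ?B"
  \<comment> \<open>If one of the three is infinite, so are both right-hand sides; otherwise the
    argument takes place in the reals.\<close>
  proof (cases "u = \<top> \<or> v = \<top> \<or> s = \<top>")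
    case True
    then show ?thesis
      by (auto simp: ennreal_mult_top)
  next
    case False
    then obtain u' v' s' where u: "u = ennreal u'" "0 \<le> u'" and v: "v = ennreal v'" "0 \<le> v'"
      and s: "s = ennreal s'" "0 \<le> s'"
      by (metis ennreal_cases)
    have ex1: "l (Ah \<eta> x) (L \<eta> f) \<le> \<Psi> \<eta> x + u'" if "\<eta> \<in> H" for \<eta>
      using le_add_excess1[OF q that, of l Ah x L f \<Psi>] u pos[of \<eta>]
      by (simp add: u_def flip: ennreal_plus)
    have ex2: "l (Ap h \<eta> x) (Lp h \<eta> f) \<le> \<Psi> \<eta> x + v'" if "\<eta> \<in> H" for \<eta>
      using le_add_excess2[OF q h that, of l Ap x Lp f \<Psi>] v pos[of \<eta>] pos[of h]
      by (simp add: v_def min_def flip: ennreal_plus split: if_splits)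
    have sup: "l (Lp h \<eta> f) (L \<eta> f) \<le> s'" if "\<eta> \<in> H" for \<eta>
      using SUP_upper[OF that, of "\<lambda>\<eta>. ennreal (l (Lp h \<eta> f) (L \<eta> f))"] s
      by (simp add: s_def)
    \<comment> \<open>The path from \<open>Ap h \<eta>\<close> to \<open>Ah \<eta>\<close> goes
      through \<open>Lp h \<eta>\<close> and \<open>L \<eta>\<close>. Its first and last legs cost
      at most \<open>\<Psi> \<eta>\<close> each, up to \<open>v'\<close> and \<open>u'\<close>; this
      is what the subtracted \<open>2 * \<Psi> \<eta>\<close> absorbs.\<close>
    have "Rhat l H Ah Ap \<Psi> h x \<le> ennreal (u' + v' + s')"
      unfolding Rhat_def
    proof (intro SUP_least ennreal_leI)
      fix \<eta> assume \<eta>: "\<eta> \<in> H"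
      show "max (l (Ap h \<eta> x) (Ah \<eta> x) - 2 * \<Psi> \<eta> x) 0 \<le> u' + v' + s'"
        using ex1[OF \<eta>] ex2[OF \<eta>] sup[OF \<eta>] u v s
          triangle[of "Ap h \<eta> x" "Ah \<eta> x" "Lp h \<eta> f"] triangle[of "Lp h \<eta> f" "Ah \<eta> x" "L \<eta> f"]
          commute[of "L \<eta> f" "Ah \<eta> x"]
        by linarith
    qed
    then obtain r where r: "Rhat l H Ah Ap \<Psi> h x = ennreal r" "0 \<le> r" "r \<le> u' + v' + s'"
      using u v s by (cases "Rhat l H Ah Ap \<Psi> h x") (auto simp: top_unique simp flip: ennreal_plus)
    have "Rhat l H Ah Ap \<Psi> k x + ennreal (2 * \<Psi> k x)
        \<le> (INF h\<in>H. Rhat l H Ah Ap \<Psi> h x + ennreal (2 * \<Psi> h x)) + ennreal e"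
      using sel by (simp add: selected_def)
    also have "\<dots> \<le> (Rhat l H Ah Ap \<Psi> h x + ennreal (2 * \<Psi> h x)) + ennreal d"
      using h e by (intro add_mono INF_lower ennreal_leI)
    also have "\<dots> = ennreal (r + 2 * \<Psi> h x + d)"
      using r e pos[of h] by simp
    finally have Rk: "Rhat l H Ah Ap \<Psi> k x + ennreal (2 * \<Psi> k x) \<le> ennreal (r + 2 * \<Psi> h x + d)" .
    \<comment> \<open>The selection rule also shows that the criterion at \<open>k\<close> is
      finite, since its value at \<open>h\<close> is.\<close>
    then obtain r' where r': "Rhat l H Ah Ap \<Psi> k x = ennreal r'" "0 \<le> r'"
      by (cases "Rhat l H Ah Ap \<Psi> k x") (auto simp: top_unique)
    have sum: "r' + 2 * \<Psi> k x \<le> r + 2 * \<Psi> h x + d"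
      using Rk r r' e pos[of h] pos[of k] by (simp flip: ennreal_plus)
    have R: "l (Ap a \<eta> x) (Ah \<eta> x) \<le> c + 2 * \<Psi> \<eta> x"
      if "\<eta> \<in> H" "Rhat l H Ah Ap \<Psi> a x = ennreal c" "0 \<le> c" for a \<eta> c
    proof -
      have "ennreal (max (l (Ap a \<eta> x) (Ah \<eta> x) - 2 * \<Psi> \<eta> x) 0) \<le> ennreal c"
        using that unfolding Rhat_def by (metis (mono_tags, lifting) SUP_upper)
      then show ?thesis
        using that(3) by (simp add: ennreal_le_iff)
    qed
    \<comment> \<open>Dropping \<open>r'\<close> and halving \<open>sum\<close> would even give half
      of \<open>s' + d + u' + v'\<close>; the cruder bound suffices.\<close>
    have \<Psi>: "\<Psi> k x \<le> s' + d + \<Psi> h x + u' + v'"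
      using sum r r' e u v s by linarith
    \<comment> \<open>The path is \<open>L k\<close>, \<open>Ah k\<close>, \<open>Ap k h\<close>,
      \<open>Ah h\<close>, \<open>L h\<close>, \<open>A\<close>. Its legs cost at most
      \<open>\<Psi> k + u'\<close>, \<open>r + 2 * \<Psi> k\<close>,
      \<open>r' + 2 * \<Psi> h\<close>, \<open>\<Psi> h + u'\<close> and the distance at
      \<open>h\<close>; symmetry of \<open>Ap\<close> yields the second one. Replacing
      \<open>r' + 2 * \<Psi> k\<close> by means of \<open>sum\<close>, then bounding the remaining
      \<open>\<Psi> k\<close> and both copies of \<open>r\<close>, produces exactly the stated
      coefficients.\<close>
    have "l (L k f) (A f) \<le> l (L h f) (A f) + 3 * s' + 2 * d + 6 * \<Psi> h x + 5 * u' + 3 * v'"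
      using R[OF h r'(1,2)] R[OF k r(1,2), unfolded sym[of h k]] sum r r' e u v s \<Psi> ex1[OF h] ex1[OF k]
        triangle[of "L k f" "A f" "Ah k x"] triangle[of "Ah k x" "A f" "Ap k h x"]
        triangle[of "Ap k h x" "A f" "Ah h x"] triangle[of "Ah h x" "A f" "L h f"]
        commute[of "Ah k x" "L k f"] commute[of "Ah k x" "Ap k h x"]
      by linarith
    with \<Psi> show ?thesis
      using u v s e nonneg[of "L h f" "A f"] pos[of h]
      by (auto simp flip: ennreal_plus ennreal_mult ennreal_numeral)
  qed
  then show ?A ?B
    by simp_all
qed

section \<open>Plug-in of the selected index, and the final constants\<close>

text \<open>The index is a function of \<open>X\<close> alone, so the inner integral over the law of
  \<open>Y\<close> treats it as fixed, and a bound for each fixed index carries over to the random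
  one.\<close>

lemma (in prob_space) nn_norm_plug_in_le:
  assumes indep: "indep_elements M S X T Y"
    and [measurable]: "X \<in> M \<rightarrow>\<^sub>M S" "Y \<in> M \<rightarrow>\<^sub>M T"
    and q: "0 < q" and H: "countable H" and k: "k \<in> S \<rightarrow>\<^sub>M count_space H"
    and g: "\<And>h. h \<in> H \<Longrightarrow> g h \<in> borel_measurable T"
    and le: "\<And>\<omega>. \<omega> \<in> space M \<Longrightarrow> nn_norm (distr M T Y) q (g (k (X \<omega>))) \<le> c \<omega>"
  shows "nn_norm M q (\<lambda>\<omega>. g (k (X \<omega>)) (Y \<omega>)) \<le> nn_norm M q c"
proof -
  have [measurable]: "(\<lambda>z. g (k (fst z)) (snd z)) \<in> borel_measurable (S \<Otimes>\<^sub>M T)"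
    \<comment> \<open>The index takes countably many values, so joint measurability reduces to that
      of each \<open>g h\<close>.\<close>
    by (rule measurable_compose_countable'[where f = "\<lambda>h z. g h (snd z)", OF _ measurable_compose[OF measurable_fst k] H])
      (rule measurable_compose[OF measurable_snd g])
  have "(\<integral>\<^sup>+\<omega>. enn_powr (g (k (X \<omega>)) (Y \<omega>)) q \<partial>M)
      = (\<integral>\<^sup>+\<omega>. \<integral>\<^sup>+y. enn_powr (g (k (X \<omega>)) y) q \<partial>distr M T Y \<partial>M)"
    using nn_integral_indep_elements[OF indep, of "\<lambda>z. enn_powr (g (k (fst z)) (snd z)) q"] by simp
  also have "\<dots> \<le> (\<integral>\<^sup>+\<omega>. enn_powr (c \<omega>) q \<partial>M)"
    using le by (intro nn_integral_mono) (simp add: nn_norm_le_iff[OF q])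
  finally show ?thesis
    unfolding nn_norm_def using q by (intro enn_powr_mono) auto
qed

text \<open>The coefficients of \<open>d\<close> agree exactly. The right-hand side exceeds the left
  by \<open>C + D\<close> times each of \<open>a\<close>, \<open>s\<close> and \<open>p\<close>, the
  price of grouping \<open>a\<close> and \<open>s\<close> into the bias
  \<open>a + 2 * s\<close>.\<close>

lemma risk_bound_arith:
  fixes a s p :: ennreal and C D d :: real
  assumes "0 < C" "0 < D" "0 \<le> d"
  shows "ennreal D * ((s + ennreal d) + p + ennreal d + ennreal d)
      + ennreal C * ((a + 3 * s + 2 * ennreal d) + 6 * p + 5 * ennreal d + 3 * ennreal d)
    \<le> (ennreal (2 * C + D) * (a + 2 * s) + ennreal (7 * C + 2 * D) * p) + ennreal ((10 * C + 3 * D) * d)"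
proof (cases "a = \<top> \<or> s = \<top> \<or> p = \<top>")
  case True
  then show ?thesis
    using assms by (auto simp: ennreal_mult_top ennreal_eq_0_iff)
next
  case False
  then obtain a' s' p' where a: "a = ennreal a'" "0 \<le> a'" and s: "s = ennreal s'" "0 \<le> s'"
    and p: "p = ennreal p'" "0 \<le> p'"
    by (metis ennreal_cases)
  have "0 \<le> C * a'" "0 \<le> C * s'" "0 \<le> C * p'" "0 \<le> D * a'" "0 \<le> D * s'" "0 \<le> D * p'"
    using assms a s p by auto
  then have "D * ((s' + d) + p' + d + d) + C * ((a' + 3 * s' + 2 * d) + 6 * p' + 5 * d + 3 * d)
      \<le> ((2 * C + D) * (a' + 2 * s') + (7 * C + 2 * D) * p') + (10 * C + 3 * D) * d"
    by (simp add: algebra_simps)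
  then show ?thesis
    using assms a s p
    by (simp add: ennreal_le_iff flip: ennreal_plus ennreal_mult ennreal_numeral)
qed

section \<open>Assembly of the risk bound\<close>

theorem proposition1:
  fixes \<Omega> :: "nat \<Rightarrow> 'w measure"
    and P :: "nat \<Rightarrow> 'f \<Rightarrow> 'w measure"
    and S1 :: "nat \<Rightarrow> 'x measure" and X1 :: "nat \<Rightarrow> 'w \<Rightarrow> 'x"
    and S2 :: "nat \<Rightarrow> 'y measure" and X2 :: "nat \<Rightarrow> 'w \<Rightarrow> 'y"
    and \<SS>1 :: "'s measure" and l :: "'s \<Rightarrow> 's \<Rightarrow> real"
    and \<SS>2 :: "'t measure" and \<rho> :: "'t \<Rightarrow> 't \<Rightarrow> real"
    and A :: "'f \<Rightarrow> 's" and B :: "'f \<Rightarrow> 't"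
    and q :: real
    and H :: "nat \<Rightarrow> 'h set"
    and Ah :: "nat \<Rightarrow> 'h \<Rightarrow> 'x \<Rightarrow> 's" and Ap :: "nat \<Rightarrow> 'h \<Rightarrow> 'h \<Rightarrow> 'x \<Rightarrow> 's"
    and \<Lambda> :: "nat \<Rightarrow> 'h \<Rightarrow> 'f \<Rightarrow> 's" and \<Lambda>p :: "nat \<Rightarrow> 'h \<Rightarrow> 'h \<Rightarrow> 'f \<Rightarrow> 's"
    and \<Psi> :: "nat \<Rightarrow> 'h \<Rightarrow> 'x \<Rightarrow> real"
    and Bh :: "nat \<Rightarrow> 'h \<Rightarrow> 'y \<Rightarrow> 't" and \<Upsilon> :: "nat \<Rightarrow> 'h \<Rightarrow> 'f \<Rightarrow> 't"
    and \<epsilon> \<epsilon>' :: "nat \<Rightarrow> real" and Cl CE :: real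
    and hsel :: "nat \<Rightarrow> 'x \<Rightarrow> 'h"
  assumes two_samples:
      "\<And>n. n \<ge> 1 \<Longrightarrow> two_sample_experiment (\<Omega> n) (P n) (S1 n) (X1 n) (S2 n) (X2 n)"
    and semimetrics: "semimetric l" "semimetric \<rho>"
    and carriers: "space \<SS>1 = UNIV" "space \<SS>2 = UNIV"
    and q: "q \<ge> 1"
    and countable_H: "\<And>n. n \<ge> 1 \<Longrightarrow> countable (H n)"
    and estimators_measurable:
      "\<And>n h. n \<ge> 1 \<Longrightarrow> Ah n h \<in> S1 n \<rightarrow>\<^sub>M \<SS>1"
      "\<And>n h \<eta>. n \<ge> 1 \<Longrightarrow> Ap n h \<eta> \<in> S1 n \<rightarrow>\<^sub>M \<SS>1"
      "\<And>n h. n \<ge> 1 \<Longrightarrow> Bh n h \<in> S2 n \<rightarrow>\<^sub>M \<SS>2"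
      "\<And>n h. n \<ge> 1 \<Longrightarrow> \<Psi> n h \<in> borel_measurable (S1 n)"
    and \<Psi>_pos: "\<And>n h \<omega>. n \<ge> 1 \<Longrightarrow> \<omega> \<in> space (\<Omega> n) \<Longrightarrow> \<Psi> n h (X1 n \<omega>) > 0"
    and \<epsilon>: "\<And>n. n \<ge> 1 \<Longrightarrow> \<epsilon> n \<ge> 0" "\<epsilon> \<longlonglongrightarrow> 0"
    \<comment> \<open>random quantities under expectations are measurable\<close>
    and expectations_measurable:
      "\<And>n f. n \<ge> 1 \<Longrightarrow> excess1 l q (H n) (Ah n) (\<Lambda> n) (\<Psi> n) f \<in> borel_measurable (S1 n)"
      "\<And>n f. n \<ge> 1 \<Longrightarrow> excess2 l q (H n) (Ap n) (\<Lambda>p n) (\<Psi> n) f \<in> borel_measurable (S1 n)"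
      "\<And>n f h. n \<ge> 1 \<Longrightarrow> h \<in> H n \<Longrightarrow> (\<lambda>y. \<rho> (Bh n h y) (\<Upsilon> n h f)) \<in> borel_measurable (S2 n)"
      "\<And>n f. n \<ge> 1 \<Longrightarrow>
         (\<lambda>\<omega>. \<rho> (Bh n (hsel n (X1 n \<omega>)) (X2 n \<omega>)) (B f)) \<in> borel_measurable (\<Omega> n)"
    and permutation:
      "\<And>n h \<eta> \<omega>. n \<ge> 1 \<Longrightarrow> \<omega> \<in> space (\<Omega> n) \<Longrightarrow> Ap n h \<eta> (X1 n \<omega>) = Ap n \<eta> h (X1 n \<omega>)"
    and upper_function:
      "\<And>n. n \<ge> 1 \<Longrightarrow>
         (SUP f. \<integral>\<^sup>+x. excess1 l q (H n) (Ah n) (\<Lambda> n) (\<Psi> n) f x \<partial>distr (P n f) (S1 n) (X1 n))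
           \<le> ennreal (\<epsilon> n powr q)"
      "\<And>n. n \<ge> 1 \<Longrightarrow>
         (SUP f. \<integral>\<^sup>+x. excess2 l q (H n) (Ap n) (\<Lambda>p n) (\<Psi> n) f x \<partial>distr (P n f) (S1 n) (X1 n))
           \<le> ennreal (\<epsilon> n powr q)"
    and Cl: "Cl > 0"
      "\<And>f n h. n \<ge> 1 \<Longrightarrow> h \<in> H n \<Longrightarrow> \<rho> (\<Upsilon> n h f) (B f) \<le> Cl * l (\<Lambda> n h f) (A f)"
    and CE: "CE > 0"
      "\<And>n h \<omega>. n \<ge> 1 \<Longrightarrow> h \<in> H n \<Longrightarrow> \<omega> \<in> space (\<Omega> n) \<Longrightarrow>
         (SUP f. moment_norm (distr (P n f) (S2 n) (X2 n)) q (\<lambda>y. \<rho> (Bh n h y) (\<Upsilon> n h f)))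
           \<le> ennreal (CE * \<Psi> n h (X1 n \<omega>))"
    and hsel_measurable: "\<And>n. n \<ge> 1 \<Longrightarrow> hsel n \<in> S1 n \<rightarrow>\<^sub>M count_space (H n)"
    and \<epsilon>': "\<And>n. n \<ge> 1 \<Longrightarrow> \<epsilon>' n \<le> \<epsilon> n"
    and selection_rule:
      "\<And>n \<omega>. n \<ge> 1 \<Longrightarrow> \<omega> \<in> space (\<Omega> n) \<Longrightarrow>
         selected l (H n) (Ah n) (Ap n) (\<Psi> n) (\<epsilon>' n) (hsel n (X1 n \<omega>)) (X1 n \<omega>)"
  shows "\<forall>f. \<forall>n\<ge>1.
    moment_norm (P n f) q (\<lambda>\<omega>. \<rho> (Bh n (hsel n (X1 n \<omega>)) (X2 n \<omega>)) (B f))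
      \<le> (INF h\<in>H n.
            ennreal (2 * Cl + CE) * bias l (H n) (\<Lambda> n) (\<Lambda>p n) A f h
            + ennreal (7 * Cl + 2 * CE) * moment_norm (distr (P n f) (S1 n) (X1 n)) q (\<Psi> n h))
        + ennreal ((10 * Cl + 3 * CE) * \<epsilon> n)"
proof (intro allI impI)
  fix f and n :: nat assume n: "1 \<le> n"
  define M where "M = P n f"
  have exper: "X1 n \<in> \<Omega> n \<rightarrow>\<^sub>M S1 n" "X2 n \<in> \<Omega> n \<rightarrow>\<^sub>M S2 n" "prob_space M" "sets M = sets (\<Omega> n)"
    and indep: "indep_elements M (S1 n) (X1 n) (S2 n) (X2 n)"
    using two_samples[OF n] by (auto simp: two_sample_experiment_def M_def)
  interpret prob_space M
    by fact
  have space: "space M = space (\<Omega> n)"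
    using exper(4) by (rule sets_eq_imp_space_eq)
  have X [measurable]: "X1 n \<in> M \<rightarrow>\<^sub>M S1 n" "X2 n \<in> M \<rightarrow>\<^sub>M S2 n"
    using exper by (simp_all cong: measurable_cong_sets)
  have q0: "0 < q"
    using q by simp
  have l0: "0 \<le> l a b" and \<rho>0: "0 \<le> \<rho> u v" and \<rho>_triangle: "\<rho> u w \<le> \<rho> u v + \<rho> v w" for a b u v w
    using semimetrics by (auto simp: semimetric_def)
  define k where "k = (\<lambda>\<omega>. hsel n (X1 n \<omega>))"
  have k: "k \<omega> \<in> H n" if "\<omega> \<in> space M" for \<omega>
    using selection_rule[OF n] that by (simp add: k_def selected_def space)
  define u where "u = (\<lambda>\<omega>. enn_powr (excess1 l q (H n) (Ah n) (\<Lambda> n) (\<Psi> n) f (X1 n \<omega>)) (1 / q))"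
  define v where "v = (\<lambda>\<omega>. enn_powr (excess2 l q (H n) (Ap n) (\<Lambda>p n) (\<Psi> n) f (X1 n \<omega>)) (1 / q))"
  define d where "d = ennreal (\<epsilon> n)"
  have [measurable]: "excess1 l q (H n) (Ah n) (\<Lambda> n) (\<Psi> n) f \<in> borel_measurable (S1 n)"
    "excess2 l q (H n) (Ap n) (\<Lambda>p n) (\<Psi> n) f \<in> borel_measurable (S1 n)"
    "\<And>h. \<Psi> n h \<in> borel_measurable (S1 n)"
    by (fact expectations_measurable[OF n] estimators_measurable[OF n])+
  have uv_measurable [measurable]: "u \<in> borel_measurable M" "v \<in> borel_measurable M"
    unfolding u_def v_def by measurable
  \<comment> \<open>The hypothesis is an expectation under the law of \<open>X1\<close>; a change of
    variables moves it to \<open>M\<close>, where the power \<open>q\<close> undoes the root in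
    \<open>u\<close>.\<close>
  have u: "nn_norm M q u \<le> d"
  proof -
    have "(\<integral>\<^sup>+\<omega>. enn_powr (u \<omega>) q \<partial>M)
        = (\<integral>\<^sup>+x. excess1 l q (H n) (Ah n) (\<Lambda> n) (\<Psi> n) f x \<partial>distr (P n f) (S1 n) (X1 n))"
      using q0 by (simp add: u_def enn_powr_enn_powr nn_integral_distr flip: M_def)
    also have "\<dots> \<le> enn_powr d q"
      using upper_function(1)[OF n] \<epsilon>(1)[OF n] by (simp add: SUP_le_iff d_def enn_powr_ennreal)
    finally show ?thesis
      by (simp add: nn_norm_le_iff[OF q0])
  qed
  have v: "nn_norm M q v \<le> d"
  proof -
    have "(\<integral>\<^sup>+\<omega>. enn_powr (v \<omega>) q \<partial>M)
        = (\<integral>\<^sup>+x. excess2 l q (H n) (Ap n) (\<Lambda>p n) (\<Psi> n) f x \<partial>distr (P n f) (S1 n) (X1 n))"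
      using q0 by (simp add: v_def enn_powr_enn_powr nn_integral_distr flip: M_def)
    also have "\<dots> \<le> enn_powr d q"
      using upper_function(2)[OF n] \<epsilon>(1)[OF n] by (simp add: SUP_le_iff d_def enn_powr_ennreal)
    finally show ?thesis
      by (simp add: nn_norm_le_iff[OF q0])
  qed
  \<comment> \<open>The stochastic part of the plug-in loss: the error around
    \<open>\<Upsilon>\<close> at the selected index.\<close>
  define Z where "Z = (\<lambda>\<omega>. ennreal (\<rho> (Bh n (k \<omega>) (X2 n \<omega>)) (\<Upsilon> n (k \<omega>) f)))"
  have Z_measurable [measurable]: "Z \<in> borel_measurable M"
    unfolding Z_def
  proof (rule measurable_compose_countable'[where f = "\<lambda>h \<omega>. ennreal (\<rho> (Bh n h (X2 n \<omega>)) (\<Upsilon> n h f))",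
        OF _ _ countable_H[OF n]])
    show "k \<in> M \<rightarrow>\<^sub>M count_space (H n)"
      unfolding k_def by (rule measurable_compose[OF X(1) hsel_measurable[OF n]])
    show "(\<lambda>\<omega>. ennreal (\<rho> (Bh n h (X2 n \<omega>)) (\<Upsilon> n h f))) \<in> borel_measurable M" if "h \<in> H n" for h
      using measurable_compose[OF X(2) expectations_measurable(3)[OF n that, of f]] by measurable
  qed
  have "nn_norm M q (\<lambda>\<omega>. ennreal (\<rho> (Bh n (k \<omega>) (X2 n \<omega>)) (\<Upsilon> n (k \<omega>) f)))
      \<le> nn_norm M q (\<lambda>\<omega>. ennreal (CE * \<Psi> n (k \<omega>) (X1 n \<omega>)))"
    unfolding k_def
  proof (rule nn_norm_plug_in_le[OF indep X q0 countable_H[OF n] hsel_measurable[OF n],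
        where g = "\<lambda>h y. ennreal (\<rho> (Bh n h y) (\<Upsilon> n h f))"])
    show "(\<lambda>y. ennreal (\<rho> (Bh n h y) (\<Upsilon> n h f))) \<in> borel_measurable (S2 n)" if "h \<in> H n" for h
      using expectations_measurable(3)[OF n that, of f] by measurable
    fix \<omega> assume \<omega>: "\<omega> \<in> space M"
    show "nn_norm (distr M (S2 n) (X2 n)) q
        (\<lambda>y. ennreal (\<rho> (Bh n (hsel n (X1 n \<omega>)) y) (\<Upsilon> n (hsel n (X1 n \<omega>)) f)))
      \<le> ennreal (CE * \<Psi> n (hsel n (X1 n \<omega>)) (X1 n \<omega>))"
      \<comment> \<open>The hypothesis bounds a nonrandom quantity by \<open>\<Psi>\<close> at every
        sample point and for every index in \<open>H n\<close>, so it may be used at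
        \<open>\<omega>\<close> with the index selected there.\<close>
      using CE(2)[OF n k[OF \<omega>] \<omega>[unfolded space]]
      by (simp add: SUP_le_iff k_def moment_norm_eq_nn_norm \<rho>0 M_def)
  qed
  then have Z: "nn_norm M q Z \<le> nn_norm M q (\<lambda>\<omega>. ennreal (CE * \<Psi> n (k \<omega>) (X1 n \<omega>)))"
    by (simp add: Z_def)
  show "moment_norm (P n f) q (\<lambda>\<omega>. \<rho> (Bh n (hsel n (X1 n \<omega>)) (X2 n \<omega>)) (B f))
      \<le> (INF h\<in>H n.
            ennreal (2 * Cl + CE) * bias l (H n) (\<Lambda> n) (\<Lambda>p n) A f h
            + ennreal (7 * Cl + 2 * CE) * moment_norm (distr (P n f) (S1 n) (X1 n)) q (\<Psi> n h))
        + ennreal ((10 * Cl + 3 * CE) * \<epsilon> n)"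
    (is "?R \<le> (INF h\<in>H n. ?rhs h) + ?e")
  proof -
    have bound: "?R \<le> ?rhs h + ?e" if h: "h \<in> H n" for h
    proof -
      define \<psi> where "\<psi> = (\<lambda>\<omega>. ennreal (\<Psi> n h (X1 n \<omega>)))"
      define p where "p = nn_norm M q \<psi>"
      define s where "s = (SUP \<eta>\<in>H n. ennreal (l (\<Lambda>p n h \<eta> f) (\<Lambda> n \<eta> f)))"
      define a where "a = ennreal (l (\<Lambda> n h f) (A f))"
      have [measurable]: "\<psi> \<in> borel_measurable M"
        unfolding \<psi>_def by measurable
      have pos: "0 < \<Psi> n \<eta> (X1 n \<omega>)" if "\<omega> \<in> space M" for \<omega> \<eta>
        using \<Psi>_pos[OF n] that by (simp add: space)
      have p: "moment_norm (distr (P n f) (S1 n) (X1 n)) q (\<Psi> n h) = p"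
      proof -
        \<comment> \<open>Positivity of \<open>\<Psi>\<close> is known only at observed values
          \<open>X1 n \<omega>\<close>, so the change of variables precedes the passage to
          \<open>nn_norm\<close>.\<close>
        have "(\<integral>\<^sup>+x. ennreal (\<Psi> n h x powr q) \<partial>distr M (S1 n) (X1 n)) = (\<integral>\<^sup>+\<omega>. enn_powr (\<psi> \<omega>) q \<partial>M)"
          by (subst nn_integral_distr)
            (auto intro!: nn_integral_cong simp: \<psi>_def enn_powr_ennreal less_imp_le pos)
        then show ?thesis
          by (simp add: moment_norm_def p_def nn_norm_def M_def)
      qed
      have \<Psi>k: "ennreal (\<Psi> n (k \<omega>) (X1 n \<omega>)) \<le> (s + d) + \<psi> \<omega> + u \<omega> + v \<omega>"
        and \<Lambda>k: "ennreal (l (\<Lambda> n (k \<omega>) f) (A f)) \<le> (a + 3 * s + 2 * d) + 6 * \<psi> \<omega> + 5 * u \<omega> + 3 * v \<omega>"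
        if \<omega>: "\<omega> \<in> space M" for \<omega>
      proof -
        have \<omega>': "\<omega> \<in> space (\<Omega> n)"
          using \<omega> by (simp add: space)
        note bounds = selected_bounds[OF semimetrics(1) q0 h selection_rule[OF n \<omega>'] \<epsilon>'[OF n] \<epsilon>(1)[OF n]
            permutation[OF n \<omega>'] \<Psi>_pos[OF n \<omega>']]
        show "ennreal (\<Psi> n (k \<omega>) (X1 n \<omega>)) \<le> (s + d) + \<psi> \<omega> + u \<omega> + v \<omega>"
          unfolding k_def s_def d_def \<psi>_def u_def v_def by (rule bounds(1))
        show "ennreal (l (\<Lambda> n (k \<omega>) f) (A f)) \<le> (a + 3 * s + 2 * d) + 6 * \<psi> \<omega> + 5 * u \<omega> + 3 * v \<omega>"
          unfolding k_def a_def s_def d_def \<psi>_def u_def v_def by (rule bounds(2))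
      qed
      let ?F = "\<lambda>\<omega>. (s + d) + 1 * \<psi> \<omega> + 1 * u \<omega> + 1 * v \<omega>"
      let ?G = "\<lambda>\<omega>. (a + 3 * s + 2 * d) + 6 * \<psi> \<omega> + 5 * u \<omega> + 3 * v \<omega>"
      have "nn_norm M q ?F \<le> (s + d) + 1 * p + 1 * nn_norm M q u + 1 * nn_norm M q v"
        unfolding p_def by (rule nn_norm_affine_le[OF prob_space_axioms q]) measurable
      also have "\<dots> \<le> (s + d) + p + d + d"
        using u v by (auto intro!: add_mono)
      finally have F: "nn_norm M q ?F \<le> (s + d) + p + d + d" .
      have "nn_norm M q ?G \<le> (a + 3 * s + 2 * d) + 6 * p + 5 * nn_norm M q u + 3 * nn_norm M q v"
        unfolding p_def by (rule nn_norm_affine_le[OF prob_space_axioms q]) measurable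
      also have "\<dots> \<le> (a + 3 * s + 2 * d) + 6 * p + 5 * d + 3 * d"
        using u v by (intro add_mono mult_left_mono) auto
      finally have G: "nn_norm M q ?G \<le> (a + 3 * s + 2 * d) + 6 * p + 5 * d + 3 * d" .
      have "?R = nn_norm M q (\<lambda>\<omega>. ennreal (\<rho> (Bh n (k \<omega>) (X2 n \<omega>)) (B f)))"
        by (simp add: k_def M_def moment_norm_eq_nn_norm \<rho>0)
      \<comment> \<open>The triangle inequality through \<open>\<Upsilon>\<close> separates the
        stochastic error from the approximation error, and the latter is controlled by
        \<open>l\<close>.\<close>
      also have "\<dots> \<le> nn_norm M q (\<lambda>\<omega>. Z \<omega> + ennreal Cl * ?G \<omega>)"
      proof (rule nn_norm_mono[OF q0])
        fix \<omega> assume \<omega>: "\<omega> \<in> space M"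
        have "\<rho> (Bh n (k \<omega>) (X2 n \<omega>)) (B f)
            \<le> \<rho> (Bh n (k \<omega>) (X2 n \<omega>)) (\<Upsilon> n (k \<omega>) f) + Cl * l (\<Lambda> n (k \<omega>) f) (A f)"
          using \<rho>_triangle Cl(2)[OF n k[OF \<omega>]] by (rule order.trans[OF _ add_left_mono])
        then have "ennreal (\<rho> (Bh n (k \<omega>) (X2 n \<omega>)) (B f))
            \<le> ennreal (\<rho> (Bh n (k \<omega>) (X2 n \<omega>)) (\<Upsilon> n (k \<omega>) f) + Cl * l (\<Lambda> n (k \<omega>) f) (A f))"
          by (rule ennreal_leI)
        also have "\<dots> = Z \<omega> + ennreal Cl * ennreal (l (\<Lambda> n (k \<omega>) f) (A f))"
          using \<rho>0 l0 Cl(1) by (simp add: Z_def ennreal_mult)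
        also have "\<dots> \<le> Z \<omega> + ennreal Cl * ?G \<omega>"
          using \<Lambda>k[OF \<omega>] by (intro add_left_mono mult_left_mono) auto
        finally show "ennreal (\<rho> (Bh n (k \<omega>) (X2 n \<omega>)) (B f)) \<le> Z \<omega> + ennreal Cl * ?G \<omega>" .
      qed
      also have "\<dots> \<le> nn_norm M q Z + nn_norm M q (\<lambda>\<omega>. ennreal Cl * ?G \<omega>)"
        by (rule nn_norm_triangle[OF q]) measurable
      also have "nn_norm M q (\<lambda>\<omega>. ennreal Cl * ?G \<omega>) = ennreal Cl * nn_norm M q ?G"
        by (rule nn_norm_cmult[OF q0]) measurable
      \<comment> \<open>By monotonicity the random index disappears in favour of \<open>?F\<close>,
        a combination of measurable functions attached to the fixed competitor
        \<open>h\<close>.\<close>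
      also have "nn_norm M q Z \<le> nn_norm M q (\<lambda>\<omega>. ennreal CE * ?F \<omega>)"
        using Z
      proof (rule order.trans)
        show "nn_norm M q (\<lambda>\<omega>. ennreal (CE * \<Psi> n (k \<omega>) (X1 n \<omega>))) \<le> nn_norm M q (\<lambda>\<omega>. ennreal CE * ?F \<omega>)"
          using \<Psi>k CE(1) by (intro nn_norm_mono[OF q0]) (simp add: ennreal_mult' mult_left_mono)
      qed
      also have "nn_norm M q (\<lambda>\<omega>. ennreal CE * ?F \<omega>) = ennreal CE * nn_norm M q ?F"
        by (rule nn_norm_cmult[OF q0]) measurable
      also have "ennreal CE * nn_norm M q ?F + ennreal Cl * nn_norm M q ?G
          \<le> ennreal CE * ((s + d) + p + d + d)
            + ennreal Cl * ((a + 3 * s + 2 * d) + 6 * p + 5 * d + 3 * d)"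
        using F G by (intro add_mono mult_left_mono) auto
      also have "\<dots> \<le> (ennreal (2 * Cl + CE) * (a + 2 * s) + ennreal (7 * Cl + 2 * CE) * p) + ?e"
        unfolding d_def by (rule risk_bound_arith[OF Cl(1) CE(1) \<epsilon>(1)[OF n]])
      also have "\<dots> = ?rhs h + ?e"
        by (simp add: p bias_def a_def s_def)
      finally show ?thesis
        by simp
    qed
    \<comment> \<open>Moving the finite term \<open>?e\<close> to the left leaves the infimum alone
      on the right, where a bound for each \<open>h\<close> is enough.\<close>
    have "?R - ?e \<le> (INF h\<in>H n. ?rhs h)"
      using bound by (intro INF_greatest) (auto simp: ennreal_minus_le_iff add.commute)
    then show ?thesis
      by (simp add: ennreal_minus_le_iff add.commute)
  qed
qed

end
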